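(* Let $X$ and $Y$ be metric spaces, and let $\Psi:X\rightrightarrows Y$ and $\Phi:X\to\mathcal{B}(Y)$ be set-valued mappings. Suppose that: (i) $(X,d)$ is metrically complete; (ii) $\Psi$ is Hausdorff upper semicontinuous on $X$ and set-covering on $X$ with constant $\alpha>0$; (iii) $\Phi$ is Lipschitz on $X$ with constant $\beta\in[0,\alpha)$. Then $\operatorname{Inc}(\Phi,\Psi)\neq\varnothing$ and $$\operatorname{dist}\bigl(x,\operatorname{Inc}(\Phi,\Psi)\bigr)\le\frac{\operatorname{exc}(\Phi(x),\Psi(x))}{\alpha-\beta},\qquad\forall x\in X.$$
   Context: Conventions: metric spaces are nonempty; all set-valued mappings have nonempty closed values at every point of $X$. $\mathcal{B}(Y)$ is the collection of bounded subsets of $Y$, so $\Phi:X\to\mathcal{B}(Y)$ means that $\Phi$ is a set-valued mapping with bounded values. In a metric space, $\mathrm{B}(x,r)$ is the closed ball of center $x$ and radius $r$; $\operatorname{dist}(x,S)=\inf_{z\in S}d(z,x)$, with $\operatorname{dist}(x,\varnothing)=+\infty$; $\mathrm{B}(S,r)=\{x:\operatorname{dist}(x,S)\le r\}$; $\operatorname{exc}(A,B)=\sup_{a\in A}\operatorname{dist}(a,B)$. $\operatorname{Inc}(\Phi,\Psi)=\{x\in X:\Phi(x)\subseteq\Psi(x)\}$ is the set of set-inclusion points of the pair $(\Phi,\Psi)$. $\Psi$ is set-covering on $X$ with constant $\alpha>0$ if for every $x\in X$ and every $r>0$ there exists $u\in \mathrm{B}(x,r)$ such that $\mathrm{B}(\Psi(x),\alpha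 r)\subseteq\Psi(u)$. $\Psi$ is Hausdorff upper semicontinuous at $x_0$ if for every $\epsilon>0$ there exists $\delta>0$ such that $\Psi(x)\subseteq\mathrm{B}(\Psi(x_0),\epsilon)$ for every $x\in\mathrm{B}(x_0,\delta)$; it is so on $X$ if this holds at every $x_0\in X$. $\Phi$ is Lipschitz on $X$ with constant $\beta\ge0$ if $\operatorname{exc}(\Phi(x_1),\Phi(x_2))\le\beta\, d(x_1,x_2)$ for all $x_1,x_2\in X$. *)

theory Defs
  imports "HOL-Analysis.Analysis"
begin

(* Extended-real valued, so that the distance from the empty set is \<infinity>; the library
   function infdist returns 0 there. *)
definition pt_set_dist :: "'a::metric_space \<Rightarrow> 'a set \<Rightarrow> ereal" where
  "pt_set_dist x S = (INF z\<in>S. ereal (dist z x))"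

definition set_cball :: "'a::metric_space set \<Rightarrow> real \<Rightarrow> 'a set" where
  "set_cball S r = {x. pt_set_dist x S \<le> ereal r}"

(* For A = {} this is -\<infinity>; all sets it is applied to below are values of set-valued
   mappings, hence nonempty. *)
definition excess :: "'a::metric_space set \<Rightarrow> 'a set \<Rightarrow> ereal" where
  "excess A B = (SUP a\<in>A. pt_set_dist a B)"

definition Inc :: "('a \<Rightarrow> 'b set) \<Rightarrow> ('a \<Rightarrow> 'b set) \<Rightarrow> 'a set" where
  "Inc \<Phi> \<Psi> = {x. \<Phi> x \<subseteq> \<Psi> x}"

definition set_covering :: "real \<Rightarrow> ('a::metric_space \<Rightarrow> 'b::metric_space set) \<Rightarrow> bool" where
  "set_covering \<alpha> \<Psi> \<longleftrightarrow>
     (\<forall>x. \<forall>r>0. \<exists>u\<in>cball x r. set_cball (\<Psi> x) (\<alpha> * r) \<subseteq> \<Psi> u)"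

definition hausdorff_usc_at :: "('a::metric_space \<Rightarrow> 'b::metric_space set) \<Rightarrow> 'a \<Rightarrow> bool" where
  "hausdorff_usc_at \<Psi> x0 \<longleftrightarrow>
     (\<forall>\<epsilon>>0. \<exists>\<delta>>0. \<forall>x\<in>cball x0 \<delta>. \<Psi> x \<subseteq> set_cball (\<Psi> x0) \<epsilon>)"

definition set_lipschitz :: "real \<Rightarrow> ('a::metric_space \<Rightarrow> 'b::metric_space set) \<Rightarrow> bool" where
  "set_lipschitz \<beta> \<Phi> \<longleftrightarrow>
     (\<forall>x1 x2. excess (\<Phi> x1) (\<Phi> x2) \<le> ereal (\<beta> * dist x1 x2))"

end

theory Submission
  imports Defs
begin

text \<open>
  The proof is an iteration of Picard type. Suppose that the excess of \<open>\<Phi> x\<close> over \<open>\<Psi> x\<close> is at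
  most \<open>e\<close>. The covering property with radius \<open>e / \<alpha>\<close> gives a point \<open>u\<close> with
  \<open>dist x u \<le> e / \<alpha>\<close> and \<open>\<Phi> x \<subseteq> \<Psi> u\<close>. Since \<open>\<Phi>\<close> is Lipschitz, the excess of \<open>\<Phi> u\<close> over
  \<open>\<Psi> u\<close>, which is at most the excess of \<open>\<Phi> u\<close> over \<open>\<Phi> x\<close>, is then at most \<open>(\<beta> / \<alpha>) * e\<close>
  (lemma \<open>covering_step\<close>).

  Starting from any point \<open>x\<close>, with \<open>e\<close> its excess, which is finite because \<open>\<Phi> x\<close> is bounded, one
  obtains a sequence whose steps are bounded by the geometric sequence \<open>(e / \<alpha>) * (\<beta> / \<alpha>) ^ n\<close>. By
  completeness it converges to a point \<open>z\<close> with
  \<open>dist x z \<le> (e / \<alpha>) / (1 - \<beta> / \<alpha>) = e / (\<alpha> - \<beta>)\<close>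
  (lemma \<open>geometric_steps_convergent\<close>). The excesses tend to \<open>0\<close> along the sequence; the Lipschitz
  property of \<open>\<Phi>\<close> and the Hausdorff upper semicontinuity of \<open>\<Psi>\<close> carry this to the limit, so the
  excess at \<open>z\<close> vanishes, and \<open>\<Phi> z \<subseteq> \<Psi> z\<close> because \<open>\<Psi> z\<close> is closed
  (lemma \<open>limit_in_Inc\<close>).

  Extended-real distances to values of the mappings are replaced by the real-valued
  \<^const>\<open>infdist\<close>, with which they agree because these values are nonempty.
\<close>

lemma pt_set_dist_eq_infdist:
  assumes "S \<noteq> {}"
  shows "pt_set_dist x S = ereal (infdist x S)"
proof -
  have bdd: "bdd_below (dist x ` S)"
    by (rule bdd_belowI[of _ 0]) auto
  show ?thesis
    unfolding pt_set_dist_def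
  proof (rule antisym)
    show "(INF z\<in>S. ereal (dist z x)) \<le> ereal (infdist x S)"
    proof (rule ereal_le_epsilon2)
      fix e :: real assume "e > 0"
      then have "(INF z\<in>S. dist x z) < infdist x S + e"
        using assms by (simp add: infdist_notempty)
      then obtain z where "z \<in> S" "dist x z < infdist x S + e"
        using cINF_less_iff[OF assms bdd] by blast
      then show "(INF z\<in>S. ereal (dist z x)) \<le> ereal (infdist x S) + ereal e"
        by (intro INF_lower2[of z]) (auto simp: dist_commute)
    qed
    show "ereal (infdist x S) \<le> (INF z\<in>S. ereal (dist z x))"
      by (rule INF_greatest) (metis ereal_less_eq(3) infdist_le dist_commute)
  qed
qed

lemma mem_set_cball_iff:
  assumes "S \<noteq> {}"
  shows "x \<in> set_cball S r \<longleftrightarrow> infdist x S \<le> r"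
  by (simp add: set_cball_def pt_set_dist_eq_infdist[OF assms])

lemma excess_le_iff:
  assumes "B \<noteq> {}"
  shows "excess A B \<le> ereal r \<longleftrightarrow> (\<forall>a\<in>A. infdist a B \<le> r)"
  by (simp add: excess_def SUP_le_iff pt_set_dist_eq_infdist[OF assms])

lemma excess_nonneg:
  assumes "A \<noteq> {}" "B \<noteq> {}"
  shows "0 \<le> excess A B"
proof -
  obtain a where "a \<in> A" using assms(1) by blast
  then show ?thesis
    unfolding excess_def
    by (intro SUP_upper2[of a])
       (simp_all add: pt_set_dist_eq_infdist[OF assms(2)] infdist_nonneg)
qed

lemma excess_finite_of_bounded:
  assumes "A \<noteq> {}" "B \<noteq> {}" "bounded A"
  obtains e where "0 \<le> e" "excess A B = ereal e"
proof -
  obtain b where b: "b \<in> B" using assms(2) by blast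
  obtain M where "\<forall>a\<in>A. dist b a \<le> M"
    using assms(3) bounded_any_center[of A b] by blast
  then have "\<forall>a\<in>A. infdist a B \<le> M"
    using b by (auto intro: infdist_le2 simp: dist_commute)
  then have "excess A B \<le> ereal M"
    using assms(2) by (simp add: excess_le_iff)
  then show thesis
    using that excess_nonneg[OF assms(1,2)] by (cases "excess A B") auto
qed

text \<open>The triangle inequality for excesses, with the first set reduced to a point.\<close>

lemma infdist_le_via_set:
  assumes "B \<noteq> {}" and "infdist a B \<le> r" and "\<And>b. b \<in> B \<Longrightarrow> infdist b C \<le> s"
  shows "infdist a C \<le> r + s"
proof -
  have "infdist a C - s \<le> (INF b\<in>B. dist a b)"
  proof (rule cINF_greatest[OF assms(1)])
    fix b assume "b \<in> B"
    then show "infdist a C - s \<le> dist a b"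
      using infdist_triangle[of a C b] assms(3)[of b] by linarith
  qed
  then show ?thesis
    using assms(1,2) by (simp add: infdist_notempty)
qed

lemma geometric_steps_convergent:
  fixes f :: "nat \<Rightarrow> 'a::metric_space"
  assumes "complete (UNIV :: 'a set)" and q: "0 \<le> q" "q < 1" and c: "0 \<le> c"
    and step: "\<And>n. dist (f n) (f (Suc n)) \<le> c * q ^ n"
  obtains l where "f \<longlonglongrightarrow> l" "dist (f 0) l \<le> c / (1 - q)"
proof -
  have tail: "dist (f m) (f (m + k)) \<le> c * q ^ m * (1 - q ^ k) / (1 - q)" for m k
  proof (induction k)
    case (Suc k)
    have "dist (f m) (f (m + Suc k)) \<le> dist (f m) (f (m + k)) + dist (f (m + k)) (f (Suc (m + k)))"
      using dist_triangle by simp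
    also have "\<dots> \<le> c * q ^ m * (1 - q ^ k) / (1 - q) + c * q ^ (m + k)"
      using Suc.IH step by (rule add_mono)
    also have "\<dots> = c * q ^ m * (1 - q ^ Suc k) / (1 - q)"
      using q by (simp add: field_simps power_add)
    finally show ?case .
  qed simp
  have bound: "dist (f m) (f n) \<le> c / (1 - q) * q ^ m" if "m \<le> n" for m n
  proof -
    have "c * q ^ m * (1 - q ^ (n - m)) \<le> c * q ^ m"
      using q c by (simp add: mult_left_le)
    then have "c * q ^ m * (1 - q ^ (n - m)) / (1 - q) \<le> c * q ^ m / (1 - q)"
      using q by (intro divide_right_mono) auto
    then show ?thesis
      using tail[of m "n - m"] that by simp
  qed
  have lim0: "(\<lambda>m. c / (1 - q) * q ^ m) \<longlonglongrightarrow> 0"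
    using q by (intro tendsto_mult_right_zero LIMSEQ_power_zero) simp
  have "Cauchy f"
  proof (rule CauchyI')
    fix e :: real assume "e > 0"
    with lim0 obtain M where "\<And>m. m \<ge> M \<Longrightarrow> c / (1 - q) * q ^ m < e"
      using order_tendstoD(2)[of _ 0 sequentially e] unfolding eventually_sequentially by blast
    then show "\<exists>M. \<forall>m\<ge>M. \<forall>n>m. dist (f m) (f n) < e"
      by (intro exI[of _ M]) (auto intro: order_le_less_trans[OF bound])
  qed
  then obtain l where l: "f \<longlonglongrightarrow> l"
    using assms(1) unfolding complete_def by blast
  have "(\<lambda>n. dist (f 0) (f n)) \<longlonglongrightarrow> dist (f 0) l"
    by (intro tendsto_intros l)
  then have "dist (f 0) l \<le> c / (1 - q)"
    using bound[of 0] by (intro tendsto_upperbound[of _ _ sequentially]) auto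
  with l show thesis by (rule that)
qed

text \<open>One step of the iteration.\<close>

lemma covering_step:
  fixes \<Phi> \<Psi> :: "'a::metric_space \<Rightarrow> 'b::metric_space set"
  assumes nonempty: "\<And>x. \<Phi> x \<noteq> {}" "\<And>x. \<Psi> x \<noteq> {}"
    and covering: "set_covering \<alpha> \<Psi>" and alpha: "0 < \<alpha>"
    and lipschitz: "set_lipschitz \<beta> \<Phi>" and beta: "0 \<le> \<beta>"
    and e: "0 \<le> e" "\<And>y. y \<in> \<Phi> x \<Longrightarrow> infdist y (\<Psi> x) \<le> e"
  obtains u where "dist x u \<le> e / \<alpha>" "\<And>y. y \<in> \<Phi> u \<Longrightarrow> infdist y (\<Psi> u) \<le> \<beta> / \<alpha> * e"
proof (cases "e = 0")
  \<comment> \<open>The covering property only concerns positive radii.\<close>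
  case True
  then show ?thesis
    using that[of x] e(2) by simp
next
  case False
  then have "e / \<alpha> > 0"
    using e(1) alpha by simp
  then obtain u where u: "u \<in> cball x (e / \<alpha>)" "set_cball (\<Psi> x) (\<alpha> * (e / \<alpha>)) \<subseteq> \<Psi> u"
    using covering unfolding set_covering_def by blast
  then have du: "dist x u \<le> e / \<alpha>"
    by simp
  have sub: "\<Phi> x \<subseteq> \<Psi> u"
    using u(2) e(2) alpha nonempty(2) by (auto simp: mem_set_cball_iff)
  have "infdist y (\<Psi> u) \<le> \<beta> / \<alpha> * e" if "y \<in> \<Phi> u" for y
  proof -
    have "infdist y (\<Psi> u) \<le> infdist y (\<Phi> x)"
      using sub nonempty(1) by (intro infdist_mono)
    also have "\<dots> \<le> \<beta> * dist u x"
      using lipschitz that nonempty(1) unfolding set_lipschitz_def by (simp add: excess_le_iff)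
    also have "\<dots> \<le> \<beta> * (e / \<alpha>)"
      using du beta by (intro mult_left_mono) (simp_all add: dist_commute)
    finally show ?thesis by simp
  qed
  with du show ?thesis by (rule that)
qed

lemma limit_in_Inc:
  fixes \<Phi> \<Psi> :: "'a::metric_space \<Rightarrow> 'b::metric_space set"
  assumes nonempty: "\<And>x. \<Phi> x \<noteq> {}" "\<And>x. \<Psi> x \<noteq> {}" and closed: "closed (\<Psi> z)"
    and usc: "hausdorff_usc_at \<Psi> z" and lipschitz: "set_lipschitz \<beta> \<Phi>"
    and lim: "f \<longlonglongrightarrow> z" and c: "c \<longlonglongrightarrow> 0"
    and exc: "\<And>n y. y \<in> \<Phi> (f n) \<Longrightarrow> infdist y (\<Psi> (f n)) \<le> c n"
  shows "z \<in> Inc \<Phi> \<Psi>"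
proof -
  have "y \<in> \<Psi> z" if y: "y \<in> \<Phi> z" for y
  proof -
    have "infdist y (\<Psi> z) \<le> 0 + \<epsilon>" if "\<epsilon> > 0" for \<epsilon>
    proof -
      obtain \<delta> where \<delta>: "\<delta> > 0" "\<And>x. x \<in> cball z \<delta> \<Longrightarrow> \<Psi> x \<subseteq> set_cball (\<Psi> z) \<epsilon>"
        using usc \<open>\<epsilon> > 0\<close> unfolding hausdorff_usc_at_def by blast
      have "eventually (\<lambda>n. dist (f n) z < \<delta>) sequentially"
        using lim \<delta>(1) by (rule tendstoD)
      then have "eventually (\<lambda>n. infdist y (\<Psi> z) \<le> \<beta> * dist z (f n) + c n + \<epsilon>) sequentially"
      proof eventually_elim
        case (elim n)
        have "infdist y (\<Phi> (f n)) \<le> \<beta> * dist z (f n)"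
          using lipschitz y nonempty(1) unfolding set_lipschitz_def by (simp add: excess_le_iff)
        then have "infdist y (\<Psi> (f n)) \<le> \<beta> * dist z (f n) + c n"
          using nonempty(1) exc by (intro infdist_le_via_set)
        moreover have "infdist b (\<Psi> z) \<le> \<epsilon>" if "b \<in> \<Psi> (f n)" for b
          using \<delta>(2)[of "f n"] elim that nonempty(2)
          by (auto simp: dist_commute mem_set_cball_iff)
        ultimately show ?case
          using infdist_le_via_set[OF nonempty(2)] by blast
      qed
      moreover have "(\<lambda>n. \<beta> * dist z (f n) + c n + \<epsilon>) \<longlonglongrightarrow> \<beta> * dist z z + 0 + \<epsilon>"
        by (intro tendsto_intros lim c)
      ultimately show ?thesis
        by (intro tendsto_lowerbound[of _ _ sequentially]) simp_all
    qed
    then have "infdist y (\<Psi> z) \<le> 0"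
      by (rule field_le_epsilon)
    then show ?thesis
      using closed nonempty(2) infdist_nonneg[of y "\<Psi> z"]
      by (simp add: in_closed_iff_infdist_zero)
  qed
  then show ?thesis
    by (auto simp: Inc_def)
qed

theorem theorem3p3:
  fixes \<Psi> \<Phi> :: "'a::metric_space \<Rightarrow> 'b::metric_space set"
    and \<alpha> \<beta> :: real
  assumes Psi_values: "\<And>x. \<Psi> x \<noteq> {} \<and> closed (\<Psi> x)"
    and Phi_values: "\<And>x. \<Phi> x \<noteq> {} \<and> closed (\<Phi> x) \<and> bounded (\<Phi> x)"
    and complete: "complete (UNIV :: 'a set)"
    and usc: "\<And>x. hausdorff_usc_at \<Psi> x"
    and alpha: "\<alpha> > 0"
    and covering: "set_covering \<alpha> \<Psi>"
    and beta: "0 \<le> \<beta>" "\<beta> < \<alpha>"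
    and lipschitz: "set_lipschitz \<beta> \<Phi>"
  shows "Inc \<Phi> \<Psi> \<noteq> {} \<and>
    (\<forall>x. pt_set_dist x (Inc \<Phi> \<Psi>) \<le> excess (\<Phi> x) (\<Psi> x) / ereal (\<alpha> - \<beta>))"
proof -
  have nonempty: "\<And>x. \<Phi> x \<noteq> {}" "\<And>x. \<Psi> x \<noteq> {}"
    using Phi_values Psi_values by auto
  define q where "q = \<beta> / \<alpha>"
  have q: "0 \<le> q" "q < 1"
    using alpha beta by (simp_all add: q_def)
  have "\<exists>z\<in>Inc \<Phi> \<Psi>. ereal (dist z x) \<le> excess (\<Phi> x) (\<Psi> x) / ereal (\<alpha> - \<beta>)" for x
  proof -
    obtain e where e: "0 \<le> e" "excess (\<Phi> x) (\<Psi> x) = ereal e"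
      using excess_finite_of_bounded[of "\<Phi> x" "\<Psi> x"] nonempty Phi_values by blast
    then have e_bound: "\<forall>y\<in>\<Phi> x. infdist y (\<Psi> x) \<le> e"
      using excess_le_iff[OF nonempty(2), of "\<Phi> x" x e] by simp
    have "\<exists>f. \<forall>n. ((n = 0 \<longrightarrow> f n = x) \<and> (\<forall>y\<in>\<Phi> (f n). infdist y (\<Psi> (f n)) \<le> e * q ^ n))
        \<and> dist (f n) (f (Suc n)) \<le> e / \<alpha> * q ^ n"
    proof (rule dependent_nat_choice)
      show "\<exists>v. (0 = (0::nat) \<longrightarrow> v = x) \<and> (\<forall>y\<in>\<Phi> v. infdist y (\<Psi> v) \<le> e * q ^ 0)"
        using e_bound by auto
    next
      fix v and n :: nat
      assume v: "(n = 0 \<longrightarrow> v = x) \<and> (\<forall>y\<in>\<Phi> v. infdist y (\<Psi> v) \<le> e * q ^ n)"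
      have "0 \<le> e * q ^ n"
        using e(1) q(1) by simp
      then obtain u where "dist v u \<le> e * q ^ n / \<alpha>"
        "\<And>y. y \<in> \<Phi> u \<Longrightarrow> infdist y (\<Psi> u) \<le> \<beta> / \<alpha> * (e * q ^ n)"
        using covering_step[of \<Phi> \<Psi> \<alpha> \<beta> "e * q ^ n" v]
          nonempty covering alpha lipschitz beta(1) v by blast
      then show "\<exists>u. ((Suc n = 0 \<longrightarrow> u = x) \<and> (\<forall>y\<in>\<Phi> u. infdist y (\<Psi> u) \<le> e * q ^ Suc n))
          \<and> dist v u \<le> e / \<alpha> * q ^ n"
        by (intro exI[of _ u]) (auto simp: q_def mult_ac)
    qed
    then obtain f where f0: "f 0 = x"
      and exc: "\<And>n y. y \<in> \<Phi> (f n) \<Longrightarrow> infdist y (\<Psi> (f n)) \<le> e * q ^ n"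
      and step: "\<And>n. dist (f n) (f (Suc n)) \<le> e / \<alpha> * q ^ n"
      by blast
    obtain z where z: "f \<longlonglongrightarrow> z" "dist (f 0) z \<le> e / \<alpha> / (1 - q)"
      using geometric_steps_convergent[OF complete q _ step] e(1) alpha by auto
    have "(\<lambda>n. e * q ^ n) \<longlonglongrightarrow> 0"
      using q by (intro tendsto_mult_right_zero LIMSEQ_power_zero) simp
    then have "z \<in> Inc \<Phi> \<Psi>"
      using limit_in_Inc[OF nonempty _ usc lipschitz z(1) _ exc] Psi_values by blast
    moreover have "\<alpha> * (1 - q) = \<alpha> - \<beta>"
      using alpha by (simp add: q_def right_diff_distrib)
    then have "ereal (dist z x) \<le> excess (\<Phi> x) (\<Psi> x) / ereal (\<alpha> - \<beta>)"
      using z(2) f0 e(2) beta(2) by (simp add: dist_commute)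
    ultimately show ?thesis by blast
  qed
  then show ?thesis
    unfolding pt_set_dist_def by (blast intro: INF_lower2)
qed

end
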